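(* Let $n\ge2$, let $a\in L^n(\mathbb{H}^n)$ be a $1$-form with $d^*a=0$, and suppose that the Navier–Stokes mild solution $u$ with initial datum $a$ described in the context is global ($T=\infty$). Then $$\lim_{T\to\infty}\frac1T\int_0^T\|u(t)\|_{L^n(\mathbb{H}^n)}\,dt=0$$ and $$\lim_{t\to\infty}\|u(t)\|_{L^n(\mathbb{H}^n)}=0.$$
   Context: $\mathbb{H}^n$ is the $n$-dimensional hyperbolic space of constant sectional curvature $-1$ with metric $g$. $L^q(\mathbb{H}^n)$ denotes the $L^q$ space for functions, forms and tensors alike. $BC(I,X)$ is the space of bounded continuous functions from $I$ to $X$. $\nabla$ is the Levi-Civita connection, $d$ the exterior derivative, $d^*$ its formal adjoint, $\#$ and $\flat$ the musical isomorphisms; $\Delta_g f=\mathrm{div}(\mathrm{grad} f)$, $\Delta_{B,1}=-\nabla^*\nabla$ on $1$-forms, $\Delta_{H,1}=d^*d+dd^*$. $\mathbb{P}=I-d(-\Delta_g)^{-1}d^*$ on $1$-forms. $L=-2\,\mathrm{Def}^*\mathrm{Def}=-\Delta_{H,1}-dd^*+2\mathrm{Ric}$, where $\mathrm{Def}\,u=\frac12(\nabla u+(\nabla u)^T)$ and, on $\mathbb{H}^n$, $\mathrm{Ric}=-(n-1)I$; when $d^*u=0$ one has $Lu=\Delta_{B,1}u-(n-1)u$. $e^{tL}$ is the semigroup generated by $L$ on $L^p$ $1$-forms. A mild solution on $[0,T)$ with datum $a$, $d^*a=0$, is a time-dependent $1$-form $u$ with $$u(t)=e^{tL}a-\int_0^t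 e^{(t-s)L}\,\mathbb{P}\big((\mathrm{div}(u^{\#}\otimes u^{\#}))^{\flat}\big)(s)\,ds,\qquad 0\le t<T.$$ The solution $u$ with time of existence $T>0$ is the unique mild solution on $[0,T)$ such that for every $n\le q<\infty$ there are $\beta,\beta''>0$ with $t^{\frac12-\frac{n}{2q}}e^{t\beta}u\in BC([0,T),L^q(\mathbb{H}^n))$ and $t^{1-\frac{n}{2q}}e^{t\beta''}\nabla u\in BC([0,T),L^q(\mathbb{H}^n))$, both with value zero at $t=0$, except for $q=n$ in the first, in which case $u(0)=a$. It is called global when all of this holds with $T=\infty$ (there is $\lambda>0$ such that this is the case whenever $\|a\|_{L^n(\mathbb{H}^n)}\le\lambda$). *)

theory Defs
  imports "HOL-Analysis.Analysis"
begin

text \<open>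
  Hyperbolic space of dimension \<open>CARD('n)\<close> is the Poincare ball: the open unit ball of
  \<open>real^'n\<close> with the metric \<open>g = (2 / (1 - |x|^2))^2 \<delta>\<close>, of constant curvature \<open>-1\<close>.  The
  coordinates are global, so functions, vector fields, 1-forms and 2-tensors are given by their
  components; values outside the ball never matter.  Sobolev-type objects are understood in the
  sense of distributions, i.e. by pairing with smooth fields compactly supported in the ball, and
  equality of such objects is equality almost everywhere.
\<close>

type_synonym 'n scalar_field = "real^'n \<Rightarrow> real"
type_synonym 'n vector_field = "real^'n \<Rightarrow> real^'n"
type_synonym 'n one_form = "real^'n \<Rightarrow> real^'n"
type_synonym 'n two_tensor = "real^'n \<Rightarrow> real^'n^'n"


subsection \<open>Metric, volume and Levi-Civita connection\<close>

definition hyp_metric :: "real^'n \<Rightarrow> real^'n^'n" where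
  "hyp_metric x = (2 / (1 - (norm x)^2))^2 *\<^sub>R mat 1"

definition hyp_cometric :: "real^'n \<Rightarrow> real^'n^'n" where
  "hyp_cometric x = matrix_inv (hyp_metric x)"

definition hyp_vol :: "(real^'n) measure" where
  "hyp_vol = density (lebesgue_on (ball 0 1)) (\<lambda>x. ennreal (sqrt (det (hyp_metric x))))"

definition partial :: "'n::finite \<Rightarrow> 'n scalar_field \<Rightarrow> 'n scalar_field" where
  "partial i f x = frechet_derivative f (at x) (axis i 1)"

definition christoffel :: "real^'n \<Rightarrow> 'n \<Rightarrow> 'n \<Rightarrow> 'n \<Rightarrow> real" where
  "christoffel x k i j =
     (\<Sum>l\<in>UNIV. hyp_cometric x $ k $ l *
        (partial i (\<lambda>y. hyp_metric y $ j $ l) x + partial j (\<lambda>y. hyp_metric y $ i $ l) x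
          - partial l (\<lambda>y. hyp_metric y $ i $ j) x)) / 2"

definition sharp :: "'n::finite one_form \<Rightarrow> 'n vector_field" where
  "sharp u x = hyp_cometric x *v u x"

definition flat :: "'n::finite vector_field \<Rightarrow> 'n one_form" where
  "flat X x = hyp_metric x *v X x"

definition inner_form :: "real^'n \<Rightarrow> real^'n \<Rightarrow> real^'n \<Rightarrow> real" where
  "inner_form x v w = (\<Sum>i\<in>UNIV. \<Sum>j\<in>UNIV. hyp_cometric x $ i $ j * v $ i * w $ j)"

definition inner_tensor :: "real^'n \<Rightarrow> real^'n^'n \<Rightarrow> real^'n^'n \<Rightarrow> real" where
  "inner_tensor x V W =
     (\<Sum>i\<in>UNIV. \<Sum>j\<in>UNIV. \<Sum>k\<in>UNIV. \<Sum>l\<in>UNIV.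
        hyp_cometric x $ i $ k * hyp_cometric x $ j $ l * V $ i $ j * W $ k $ l)"

definition norm_scalar :: "real^'n \<Rightarrow> real \<Rightarrow> real" where
  "norm_scalar x r = \<bar>r\<bar>"

definition norm_form :: "real^'n \<Rightarrow> real^'n \<Rightarrow> real" where
  "norm_form x v = sqrt (inner_form x v v)"

definition norm_tensor :: "real^'n \<Rightarrow> real^'n^'n \<Rightarrow> real" where
  "norm_tensor x V = sqrt (inner_tensor x V V)"


subsection \<open>Differential operators on smooth fields\<close>

definition ext_d :: "'n::finite scalar_field \<Rightarrow> 'n one_form" where
  "ext_d f x = (\<chi> i. partial i f x)"

definition div_vec :: "'n::finite vector_field \<Rightarrow> 'n scalar_field" where
  "div_vec X x =
     (\<Sum>i\<in>UNIV. partial i (\<lambda>y. X y $ i) x + (\<Sum>k\<in>UNIV. christoffel x i i k * X x $ k))"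

definition laplace_g :: "'n::finite scalar_field \<Rightarrow> 'n scalar_field" where
  "laplace_g f = div_vec (sharp (ext_d f))"

definition codiff :: "'n::finite one_form \<Rightarrow> 'n scalar_field" where
  "codiff u x = - div_vec (sharp u) x"

text \<open>The first index of a covariant derivative is the direction of differentiation.\<close>

definition nabla :: "'n::finite one_form \<Rightarrow> 'n two_tensor" where
  "nabla u x =
     (\<chi> i j. partial i (\<lambda>y. u y $ j) x - (\<Sum>k\<in>UNIV. christoffel x k i j * u x $ k))"

definition nabla_tensor :: "'n two_tensor \<Rightarrow> real^'n \<Rightarrow> 'n \<Rightarrow> 'n \<Rightarrow> 'n \<Rightarrow> real" where
  "nabla_tensor V x k i j =
     partial k (\<lambda>y. V y $ i $ j) x
       - (\<Sum>l\<in>UNIV. christoffel x l k i * V x $ l $ j)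
       - (\<Sum>l\<in>UNIV. christoffel x l k j * V x $ i $ l)"

text \<open>The formal adjoint of \<^const>\<open>nabla\<close>.\<close>

definition nabla_star :: "'n::finite two_tensor \<Rightarrow> 'n one_form" where
  "nabla_star V x =
     (\<chi> j. - (\<Sum>i\<in>UNIV. \<Sum>k\<in>UNIV. hyp_cometric x $ i $ k * nabla_tensor V x k i j))"

definition deformation :: "'n::finite one_form \<Rightarrow> 'n two_tensor" where
  "deformation u x = (1/2) *\<^sub>R (nabla u x + transpose (nabla u x))"

text \<open>The formal adjoint of \<^const>\<open>deformation\<close>, for which only the symmetric part counts.\<close>

definition def_star :: "'n::finite two_tensor \<Rightarrow> 'n one_form" where
  "def_star V = nabla_star (\<lambda>x. (1/2) *\<^sub>R (V x + transpose (V x)))"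

definition op_L :: "'n::finite one_form \<Rightarrow> 'n one_form" where
  "op_L u x = - 2 *\<^sub>R def_star (deformation u) x"


subsection \<open>Test fields\<close>

primrec Ck :: "nat \<Rightarrow> 'n::finite scalar_field \<Rightarrow> bool" where
  "Ck 0 f \<longleftrightarrow> continuous_on UNIV f"
| "Ck (Suc k) f \<longleftrightarrow> (\<forall>x. f differentiable (at x)) \<and> (\<forall>i. Ck k (partial i f))"

definition compact_support :: "(real^'n \<Rightarrow> 'b::zero) \<Rightarrow> bool" where
  "compact_support f \<longleftrightarrow> (\<exists>K. compact K \<and> K \<subseteq> ball 0 1 \<and> (\<forall>x. x \<notin> K \<longrightarrow> f x = 0))"

definition test_scalar :: "'n::finite scalar_field \<Rightarrow> bool" where
  "test_scalar f \<longleftrightarrow> compact_support f \<and> (\<forall>k. Ck k f)"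

definition test_form :: "'n::finite one_form \<Rightarrow> bool" where
  "test_form \<psi> \<longleftrightarrow> compact_support \<psi> \<and> (\<forall>i k. Ck k (\<lambda>x. \<psi> x $ i))"

definition test_tensor :: "'n::finite two_tensor \<Rightarrow> bool" where
  "test_tensor \<Phi> \<longleftrightarrow> compact_support \<Phi> \<and> (\<forall>i j k. Ck k (\<lambda>x. \<Phi> x $ i $ j))"

definition locally_integrable :: "(real^'n \<Rightarrow> 'b::euclidean_space) \<Rightarrow> bool" where
  "locally_integrable f \<longleftrightarrow> (\<forall>K. compact K \<and> K \<subseteq> ball 0 1 \<longrightarrow> set_integrable hyp_vol K f)"


subsection \<open>Lebesgue spaces\<close>

text \<open>The parameter \<open>N\<close> is the pointwise norm: \<^const>\<open>norm_scalar\<close>, \<^const>\<open>norm_form\<close> or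
  \<^const>\<open>norm_tensor\<close>.  \<open>Lq_norm\<close> is meaningful for fields in \<open>Lq\<close>.\<close>

definition Lq :: "(real^'n \<Rightarrow> 'b \<Rightarrow> real) \<Rightarrow> real \<Rightarrow> (real^'n \<Rightarrow> 'b::euclidean_space) \<Rightarrow> bool" where
  "Lq N q f \<longleftrightarrow> f \<in> borel_measurable hyp_vol \<and> integrable hyp_vol (\<lambda>x. N x (f x) powr q)"

definition Lq_norm ::
    "(real^'n \<Rightarrow> 'b \<Rightarrow> real) \<Rightarrow> real \<Rightarrow> (real^'n \<Rightarrow> 'b::euclidean_space) \<Rightarrow> real" where
  "Lq_norm N q f = (LINT x|hyp_vol. N x (f x) powr q) powr (1/q)"

definition BC ::
    "(real^'n \<Rightarrow> 'b \<Rightarrow> real) \<Rightarrow> real \<Rightarrow> real set \<Rightarrow>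
      (real \<Rightarrow> real^'n \<Rightarrow> 'b::euclidean_space) \<Rightarrow> bool" where
  "BC N q I F \<longleftrightarrow>
     (\<forall>t\<in>I. Lq N q (F t)) \<and>
     (\<exists>C. \<forall>t\<in>I. Lq_norm N q (F t) \<le> C) \<and>
     (\<forall>t\<in>I. ((\<lambda>s. Lq_norm N q (\<lambda>x. F s x - F t x)) \<longlongrightarrow> 0) (at t within I))"

text \<open>The Bochner integral of an \<open>L\<^sup>q\<close>-valued function of time over a finite measure space \<open>M\<close>,
  defined by approximation as \<^const>\<open>has_bochner_integral\<close>; the latter cannot be used because \<open>L\<^sup>q\<close>
  is not a type.\<close>

definition has_Lq_integral ::
    "real \<Rightarrow> real measure \<Rightarrow> (real \<Rightarrow> 'n::finite one_form) \<Rightarrow> 'n one_form \<Rightarrow> bool" where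
  "has_Lq_integral q M F J \<longleftrightarrow>
     (\<forall>r\<in>space M. Lq norm_form q (F r)) \<and> Lq norm_form q J \<and>
     (\<exists>s. (\<forall>k. simple_function M (s k) \<and> (\<forall>r\<in>space M. Lq norm_form q (s k r)) \<and>
               (\<lambda>r. Lq_norm norm_form q (\<lambda>x. F r x - s k r x)) \<in> borel_measurable M) \<and>
          (\<lambda>k::nat. \<integral>\<^sup>+ r. ennreal (Lq_norm norm_form q (\<lambda>x. F r x - s k r x)) \<partial>M)
             \<longlonglongrightarrow> 0 \<and>
          (\<lambda>k. Lq_norm norm_form q
             (\<lambda>x. (\<Sum>v \<in> s k ` space M. measure M (s k -` {v} \<inter> space M) *\<^sub>R v x) - J x))
             \<longlonglongrightarrow> 0)"


subsection \<open>Differential operators in the sense of distributions\<close>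

definition weak_d :: "'n::finite scalar_field \<Rightarrow> 'n one_form \<Rightarrow> bool" where
  "weak_d \<phi> \<eta> \<longleftrightarrow> locally_integrable \<phi> \<and> locally_integrable \<eta> \<and>
     (\<forall>\<psi>. test_form \<psi> \<longrightarrow>
        (LINT x|hyp_vol. inner_form x (\<eta> x) (\<psi> x)) = (LINT x|hyp_vol. \<phi> x * codiff \<psi> x))"

definition weak_codiff_zero :: "'n::finite one_form \<Rightarrow> bool" where
  "weak_codiff_zero w \<longleftrightarrow> locally_integrable w \<and>
     (\<forall>\<zeta>. test_scalar \<zeta> \<longrightarrow> (LINT x|hyp_vol. inner_form x (w x) (ext_d \<zeta> x)) = 0)"

text \<open>\<open>-\<Delta>\<^sub>g \<phi> = d\<^sup>* w\<close>\<close>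

definition weak_poisson :: "'n::finite scalar_field \<Rightarrow> 'n one_form \<Rightarrow> bool" where
  "weak_poisson \<phi> w \<longleftrightarrow> locally_integrable \<phi> \<and> locally_integrable w \<and>
     (\<forall>\<zeta>. test_scalar \<zeta> \<longrightarrow>
        (LINT x|hyp_vol. \<phi> x * (- laplace_g \<zeta> x)) =
        (LINT x|hyp_vol. inner_form x (w x) (ext_d \<zeta> x)))"

definition weak_nabla :: "'n::finite one_form \<Rightarrow> 'n two_tensor \<Rightarrow> bool" where
  "weak_nabla u V \<longleftrightarrow> locally_integrable u \<and> locally_integrable V \<and>
     (\<forall>\<Phi>. test_tensor \<Phi> \<longrightarrow>
        (LINT x|hyp_vol. inner_tensor x (V x) (\<Phi> x)) =
        (LINT x|hyp_vol. inner_form x (u x) (nabla_star \<Phi> x)))"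

text \<open>\<open>L u = f\<close>; note that \<open>L\<close> is formally self-adjoint.\<close>

definition weak_L :: "'n::finite one_form \<Rightarrow> 'n one_form \<Rightarrow> bool" where
  "weak_L u f \<longleftrightarrow> locally_integrable u \<and> locally_integrable f \<and>
     (\<forall>\<psi>. test_form \<psi> \<longrightarrow>
        (LINT x|hyp_vol. inner_form x (f x) (\<psi> x)) =
        (LINT x|hyp_vol. inner_form x (u x) (op_L \<psi> x)))"

definition tensor_prod :: "'n::finite vector_field \<Rightarrow> 'n vector_field \<Rightarrow> 'n two_tensor" where
  "tensor_prod X Y x = (\<chi> i j. X x $ i * Y x $ j)"

text \<open>\<open>div T = W\<close> for a contravariant tensor \<open>T\<close> and a vector field \<open>W\<close>, that is,
  \<open>\<nabla>\<^sub>i T\<^sup>i\<^sup>j = W\<^sup>j\<close>; testing against 1-forms uses the metric-free pairing.\<close>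

definition weak_div_tensor :: "'n::finite two_tensor \<Rightarrow> 'n vector_field \<Rightarrow> bool" where
  "weak_div_tensor T W \<longleftrightarrow> locally_integrable T \<and> locally_integrable W \<and>
     (\<forall>\<psi>. test_form \<psi> \<longrightarrow>
        (LINT x|hyp_vol. (\<Sum>j\<in>UNIV. W x $ j * \<psi> x $ j)) =
        - (LINT x|hyp_vol. (\<Sum>i\<in>UNIV. \<Sum>j\<in>UNIV. T x $ i $ j * nabla \<psi> x $ i $ j)))"


subsection \<open>The projection and the semigroup\<close>

text \<open>\<open>v = P w\<close> with \<open>P = I - d (-\<Delta>\<^sub>g)\<^sup>-\<^sup>1 d\<^sup>*\<close> on \<open>L\<^sup>q\<close>: here \<open>\<phi> = (-\<Delta>\<^sub>g)\<^sup>-\<^sup>1 d\<^sup>* w\<close> is the solution in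
  \<open>L\<^sup>q\<close> of \<open>-\<Delta>\<^sub>g \<phi> = d\<^sup>* w\<close>, and \<open>\<eta> = d \<phi>\<close>.\<close>

definition leray :: "real \<Rightarrow> 'n::finite one_form \<Rightarrow> 'n one_form \<Rightarrow> bool" where
  "leray q w v \<longleftrightarrow> Lq norm_form q w \<and> Lq norm_form q v \<and>
     (\<exists>\<phi> \<eta>. Lq norm_scalar q \<phi> \<and> Lq norm_form q \<eta> \<and> weak_poisson \<phi> w \<and> weak_d \<phi> \<eta> \<and>
            (AE x in hyp_vol. v x = w x - \<eta> x))"

definition C0_semigroup :: "real \<Rightarrow> (real \<Rightarrow> 'n::finite one_form \<Rightarrow> 'n one_form) \<Rightarrow> bool" where
  "C0_semigroup p S \<longleftrightarrow>
     (\<forall>t\<ge>0. \<forall>v. Lq norm_form p v \<longrightarrow> Lq norm_form p (S t v)) \<and>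
     (\<forall>t\<ge>0. \<forall>v w a b. Lq norm_form p v \<and> Lq norm_form p w \<longrightarrow>
        (AE x in hyp_vol. S t (\<lambda>y. a *\<^sub>R v y + b *\<^sub>R w y) x = a *\<^sub>R S t v x + b *\<^sub>R S t w x)) \<and>
     (\<forall>t\<ge>0. \<exists>C. \<forall>v. Lq norm_form p v \<longrightarrow>
        Lq_norm norm_form p (S t v) \<le> C * Lq_norm norm_form p v) \<and>
     (\<forall>v. Lq norm_form p v \<longrightarrow> (AE x in hyp_vol. S 0 v x = v x)) \<and>
     (\<forall>t\<ge>0. \<forall>r\<ge>0. \<forall>v. Lq norm_form p v \<longrightarrow> (AE x in hyp_vol. S (t + r) v x = S t (S r v) x)) \<and>
     (\<forall>v. Lq norm_form p v \<longrightarrow>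
        ((\<lambda>t. Lq_norm norm_form p (\<lambda>x. S t v x - v x)) \<longlongrightarrow> 0) (at_right 0))"

text \<open>\<open>S t = e\<^sup>t\<^sup>L\<close> on \<open>L\<^sup>p\<close>: the infinitesimal generator of \<open>S\<close> is \<open>L\<close> with domain
  \<open>{v \<in> L\<^sup>p. L v \<in> L\<^sup>p}\<close>.\<close>

definition semigroup_of_L :: "real \<Rightarrow> (real \<Rightarrow> 'n::finite one_form \<Rightarrow> 'n one_form) \<Rightarrow> bool" where
  "semigroup_of_L p S \<longleftrightarrow> C0_semigroup p S \<and>
     (\<forall>v f. Lq norm_form p v \<and> Lq norm_form p f \<longrightarrow>
        (((\<lambda>h. Lq_norm norm_form p (\<lambda>x. (1/h) *\<^sub>R (S h v x - v x) - f x)) \<longlongrightarrow> 0) (at_right 0)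
          \<longleftrightarrow> weak_L v f))"


subsection \<open>The Navier--Stokes solution\<close>

definition time_interval :: "ereal \<Rightarrow> real set" where
  "time_interval T = {t. 0 \<le> t \<and> ereal t < T}"

text \<open>The integral equation is read in \<open>L\<^sup>n\<close>.  The value \<open>N s = P ((div (u\<^sup># \<otimes> u\<^sup>#))\<^sup>\<flat>) (s)\<close> makes
  sense only for \<open>s > 0\<close>; for solutions in the class below it lies in \<open>L\<^sup>n\<close>, since \<open>u s\<close> and
  \<open>\<nabla> (u s)\<close> are in \<open>L\<^sup>2\<^sup>n\<close>.\<close>

definition mild_solution ::
    "ereal \<Rightarrow> 'n::finite one_form \<Rightarrow> (real \<Rightarrow> 'n one_form) \<Rightarrow> bool" where
  "mild_solution T a u \<longleftrightarrow>
     (\<exists>S N. semigroup_of_L (real CARD('n)) S \<and>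
        (\<forall>s\<in>time_interval T. s > 0 \<longrightarrow>
           (\<exists>W. weak_div_tensor (tensor_prod (sharp (u s)) (sharp (u s))) W \<and>
                leray (real CARD('n)) (flat W) (N s))) \<and>
        (\<forall>t\<in>time_interval T.
           \<exists>J. has_Lq_integral (real CARD('n)) (lebesgue_on {0<..<t}) (\<lambda>s. S (t - s) (N s)) J \<and>
               (AE x in hyp_vol. u t x = S t a x - J x)))"

text \<open>The explicit zero values at \<open>t = 0\<close> encode that the weighted functions vanish there, where
  \<open>u 0 = a\<close> need not be in \<open>L\<^sup>q\<close> for \<open>q > n\<close> and \<open>\<nabla>u\<close> need not exist.  The case \<open>q = n\<close>, in which
  the weight of \<open>u\<close> is \<open>1\<close>, is separate (also because \<open>0 powr 0 = 0\<close>).\<close>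

definition NS_solution ::
    "ereal \<Rightarrow> 'n::finite one_form \<Rightarrow> (real \<Rightarrow> 'n one_form) \<Rightarrow> bool" where
  "NS_solution T a u \<longleftrightarrow>
     0 < T \<and> mild_solution T a u \<and>
     (AE x in hyp_vol. u 0 x = a x) \<and>
     (\<exists>V. (\<forall>t\<in>time_interval T. t > 0 \<longrightarrow> weak_nabla (u t) (V t)) \<and>
        (\<forall>q\<ge>real CARD('n).
           (\<exists>\<beta>>0. BC norm_form q (time_interval T)
              (if q = real CARD('n) then (\<lambda>t x. exp (t * \<beta>) *\<^sub>R u t x)
               else (\<lambda>t x. if t = 0 then 0
                     else (t powr (1/2 - real CARD('n) / (2 * q)) * exp (t * \<beta>)) *\<^sub>R u t x))) \<and>
           (\<exists>\<beta>>0. BC norm_tensor q (time_interval T)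
              (\<lambda>t x. if t = 0 then 0
                     else (t powr (1 - real CARD('n) / (2 * q)) * exp (t * \<beta>)) *\<^sub>R V t x))))"

end

theory Submission
  imports Defs "HOL-Real_Asymp.Real_Asymp"
begin

text \<open>
  The solution class carries exponential weights also at the scaling-critical exponent \<open>q = n\<close>,
  where the power of \<open>t\<close> is trivial: \<open>e\<^sup>\<beta>\<^sup>t u\<close> is bounded in \<open>L\<^sup>n\<close> uniformly in time for some
  \<open>\<beta> > 0\<close>.  Since the norm is homogeneous, \<open>\<parallel>u(t)\<parallel> \<le> C e\<^sup>-\<^sup>\<beta>\<^sup>t\<close> (\<open>NS_solution_exp_decay\<close>).  This
  gives the limit of the norm.  It also bounds \<open>\<integral>\<^sub>0\<^sup>T \<parallel>u(t)\<parallel> dt\<close> by \<open>C / \<beta>\<close>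
  independently of \<open>T\<close> (\<open>integral_exp_decay_bound\<close>), so that the time averages are \<open>O(1 / T)\<close>.
  The curvature enters only through these weights, which reflect the spectral gap of \<open>L\<close>.
\<close>

lemma norm_form_scaleR: "norm_form x (c *\<^sub>R v) = \<bar>c\<bar> * norm_form x v"
proof -
  have "inner_form x (c *\<^sub>R v) (c *\<^sub>R v) = c\<^sup>2 * inner_form x v v"
    by (simp add: inner_form_def sum_distrib_left power2_eq_square mult_ac)
  then show ?thesis
    by (simp add: norm_form_def real_sqrt_mult)
qed

lemma Lq_norm_form_scaleR:
  assumes "c > 0" "q > 0"
  shows "Lq_norm norm_form q (\<lambda>x. c *\<^sub>R u x) = c * Lq_norm norm_form q u"
proof -
  have "Lq_norm norm_form q (\<lambda>x. c *\<^sub>R u x)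
      = (c powr q * (LINT x|hyp_vol. norm_form x (u x) powr q)) powr (1 / q)"
    using assms by (simp add: Lq_norm_def norm_form_scaleR powr_mult)
  also have "\<dots> = (c powr q) powr (1 / q) * Lq_norm norm_form q u"
    by (simp add: Lq_norm_def powr_mult)
  also have "(c powr q) powr (1 / q) = c"
    using assms by (simp add: powr_powr)
  finally show ?thesis .
qed

lemma NS_solution_exp_decay:
  fixes a :: "'n::finite one_form"
  assumes "NS_solution \<infinity> a u"
  obtains C \<beta> where "\<beta> > 0"
    and "\<And>t. t \<ge> 0 \<Longrightarrow> Lq_norm norm_form (real CARD('n)) (u t) \<le> C * exp (- \<beta> * t)"
proof -
  let ?n = "real CARD('n)"
  have "\<forall>q\<ge>?n. \<exists>\<beta>>0. BC norm_form q (time_interval \<infinity>)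
      (if q = ?n then (\<lambda>t x. exp (t * \<beta>) *\<^sub>R u t x)
       else (\<lambda>t x. if t = 0 then 0
             else (t powr (1/2 - ?n / (2 * q)) * exp (t * \<beta>)) *\<^sub>R u t x))"
    using assms unfolding NS_solution_def by blast
  from spec[OF this, of ?n] obtain \<beta> where \<beta>: "\<beta> > 0"
    and bc: "BC norm_form ?n (time_interval \<infinity>) (\<lambda>t x. exp (t * \<beta>) *\<^sub>R u t x)"
    by auto
  obtain C where C: "\<And>t. t \<ge> 0 \<Longrightarrow> Lq_norm norm_form ?n (\<lambda>x. exp (t * \<beta>) *\<^sub>R u t x) \<le> C"
    using bc unfolding BC_def time_interval_def by auto
  have "Lq_norm norm_form ?n (u t) \<le> C * exp (- \<beta> * t)" if "t \<ge> 0" for t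
  proof -
    have "exp (t * \<beta>) * Lq_norm norm_form ?n (u t) \<le> C"
      using C[OF that] by (simp add: Lq_norm_form_scaleR)
    then show ?thesis
      by (simp add: exp_minus field_simps)
  qed
  with \<beta> show thesis by (rule that)
qed

text \<open>
  Comparison with \<open>C e\<^sup>-\<^sup>\<beta>\<^sup>t\<close>, whose integral over \<open>[0, \<infinity>)\<close> is \<open>C / \<beta>\<close>.  If \<open>f\<close> is not integrable,
  \<^const>\<open>integral\<close> is zero by convention, and the bounds hold since \<open>C \<ge> 0\<close>.
\<close>

lemma integral_exp_decay_bound:
  fixes f :: "real \<Rightarrow> real"
  assumes "\<beta> > 0" "T \<ge> 0"
    and nonneg: "\<And>t. t \<ge> 0 \<Longrightarrow> 0 \<le> f t"
    and decay: "\<And>t. t \<ge> 0 \<Longrightarrow> f t \<le> C * exp (- \<beta> * t)"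
  shows "0 \<le> integral {0..T} f" and "integral {0..T} f \<le> C / \<beta>"
proof -
  show "0 \<le> integral {0..T} f"
    using integral_nonneg[of f "{0..T}"] nonneg
    by (cases "f integrable_on {0..T}") (auto simp: not_integrable_integral)
  have "C \<ge> 0"
    using nonneg[of 0] decay[of 0] by simp
  show "integral {0..T} f \<le> C / \<beta>"
  proof (cases "f integrable_on {0..T}")
    case True
    let ?F = "\<lambda>t. - (C / \<beta>) * exp (- \<beta> * t)"
    have "((\<lambda>t. C * exp (- \<beta> * t)) has_integral ?F T - ?F 0) {0..T}"
      using assms(1,2)
      by (intro fundamental_theorem_of_calculus)
        (auto intro!: derivative_eq_intros
          simp flip: has_real_derivative_iff_has_vector_derivative)
    then have "integral {0..T} f \<le> ?F T - ?F 0"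
      using True by (intro has_integral_le[OF integrable_integral]) (use decay in auto)
    also have "\<dots> \<le> C / \<beta>"
      using \<open>C \<ge> 0\<close> \<open>\<beta> > 0\<close> by simp
    finally show ?thesis .
  next
    case False
    then show ?thesis
      using \<open>C \<ge> 0\<close> \<open>\<beta> > 0\<close> by (simp add: not_integrable_integral)
  qed
qed

theorem theorem1p7:
  fixes a :: "'n::finite one_form" and u :: "real \<Rightarrow> 'n one_form"
  assumes "CARD('n) \<ge> 2"
    and "Lq norm_form (real CARD('n)) a"
    and "weak_codiff_zero a"
    and "NS_solution \<infinity> a u"
  shows "((\<lambda>T. (1 / T) * integral {0..T} (\<lambda>t. Lq_norm norm_form (real CARD('n)) (u t)))
            \<longlongrightarrow> 0) at_top \<and>
         ((\<lambda>t. Lq_norm norm_form (real CARD('n)) (u t)) \<longlongrightarrow> 0) at_top"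
proof -
  define f where "f t = Lq_norm norm_form (real CARD('n)) (u t)" for t
  have nonneg: "0 \<le> f t" for t
    by (simp add: f_def Lq_norm_def)
  obtain C \<beta> where \<beta>: "\<beta> > 0" and decay: "\<And>t. t \<ge> 0 \<Longrightarrow> f t \<le> C * exp (- \<beta> * t)"
    using NS_solution_exp_decay[OF assms(4)] unfolding f_def by blast
  have "((\<lambda>T. (1 / T) * integral {0..T} f) \<longlongrightarrow> 0) at_top"
  proof (rule tendsto_sandwich[where f = "\<lambda>_. 0"])
    show "((\<lambda>T. (1 / T) * (C / \<beta>)) \<longlongrightarrow> 0) at_top"
      by real_asymp
    show "\<forall>\<^sub>F T in at_top. 0 \<le> (1 / T) * integral {0..T} f"
      using eventually_gt_at_top[of 0]
    proof eventually_elim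
      case (elim T)
      then show ?case
        using integral_exp_decay_bound(1)[OF \<beta> _ nonneg decay] by simp
    qed
    show "\<forall>\<^sub>F T in at_top. (1 / T) * integral {0..T} f \<le> (1 / T) * (C / \<beta>)"
      using eventually_gt_at_top[of 0]
    proof eventually_elim
      case (elim T)
      then show ?case
        using integral_exp_decay_bound(2)[OF \<beta> _ nonneg decay]
        by (intro mult_left_mono) simp_all
    qed
  qed simp
  moreover have "(f \<longlongrightarrow> 0) at_top"
  proof (rule tendsto_sandwich[where f = "\<lambda>_. 0"])
    show "((\<lambda>t. C * exp (- \<beta> * t)) \<longlongrightarrow> 0) at_top"
      using \<beta> by real_asymp
    show "\<forall>\<^sub>F t in at_top. f t \<le> C * exp (- \<beta> * t)"
      using eventually_ge_at_top[of 0] by eventually_elim (rule decay)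
  qed (simp_all add: nonneg)
  ultimately show ?thesis
    unfolding f_def by simp
qed

end
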